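(* Let $G_1,G_2,G_3,G_4$ be the following ordered matchings: $G_1$ on vertex set $[8]$ with edges $\{1,3\},\{2,7\},\{4,5\},\{6,8\}$; $G_2$ on vertex set $[10]$ with edges $\{1,5\},\{2,3\},\{4,7\},\{6,10\},\{8,9\}$; $G_3$ on vertex set $[10]$ with edges $\{1,5\},\{2,3\},\{4,9\},\{6,7\},\{8,10\}$; $G_4$ on vertex set $[10]$ with edges $\{1,3\},\{2,7\},\{4,5\},\{6,10\},\{8,9\}$. Then $sat_{<}(n,G_i)=O(1)$ for each $i=1,2,3,4$.
   Context: An ordered graph is a finite simple graph whose vertex set is linearly ordered (identified with $[m]$ with the natural order). An ordered graph $H$ contains an ordered graph $G$ if there is an injective order-preserving map $\varphi:V(G)\to V(H)$ with $\varphi(u)\varphi(v)\in E(H)$ for all $uv\in E(G)$; otherwise $H$ avoids $G$. $H$ saturates $G$ if $H$ avoids $G$ but adding any non-edge to $H$ yields a graph containing $G$. $sat_{<}(n,G)$ is the minimum number of edges of an ordered graph on $n$ vertices saturating $G$. (In the paper's notation $G_1,G_2,G_3,G_4$ are the linked matchings $\Gamma_{\{0,1,0\}},\Gamma_{\{1,0,1\}},\Gamma_{\{1,1,0\}},\Gamma_{\{0,1,1\}}$.) *)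

theory Defs
  imports Complex_Main "HOL-Library.Ramsey" "HOL-Library.Landau_Symbols"
begin

text \<open>
  An ordered graph has vertex set \<open>{1..nverts G}\<close> with the natural order; its edges are
  two-element subsets of the vertex set.
\<close>

record ograph =
  nverts :: nat
  edges :: "nat set set"

definition verts :: "ograph \<Rightarrow> nat set" where
  "verts G = {1..nverts G}"

definition ordered_graph :: "ograph \<Rightarrow> bool" where
  "ordered_graph G \<longleftrightarrow> edges G \<subseteq> nsets (verts G) 2"

definition contains :: "ograph \<Rightarrow> ograph \<Rightarrow> bool" where
  "contains H G \<longleftrightarrow>
    (\<exists>\<phi>. \<phi> ` verts G \<subseteq> verts H \<and> strict_mono_on (verts G) \<phi> \<and>
         (\<forall>u v. {u, v} \<in> edges G \<longrightarrow> {\<phi> u, \<phi> v} \<in> edges H))"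

definition avoids :: "ograph \<Rightarrow> ograph \<Rightarrow> bool" where
  "avoids H G \<longleftrightarrow> \<not> contains H G"

definition add_edge :: "nat set \<Rightarrow> ograph \<Rightarrow> ograph" where
  "add_edge e H = H\<lparr>edges := insert e (edges H)\<rparr>"

definition saturates :: "ograph \<Rightarrow> ograph \<Rightarrow> bool" where
  "saturates H G \<longleftrightarrow>
    avoids H G \<and> (\<forall>e \<in> nsets (verts H) 2 - edges H. contains (add_edge e H) G)"

definition sat :: "nat \<Rightarrow> ograph \<Rightarrow> nat" where
  "sat n G = (LEAST k. \<exists>H. ordered_graph H \<and> nverts H = n \<and> saturates H G \<and> card (edges H) = k)"

text \<open>The minimum in the definition of \<open>sat\<close> is attained as soon as \<open>G\<close> has an edge.\<close>

lemma saturating_exists: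
  assumes "ordered_graph G" and "edges G \<noteq> {}"
  shows "\<exists>H. ordered_graph H \<and> nverts H = n \<and> saturates H G"
proof -
  let ?P = "\<lambda>H. ordered_graph H \<and> nverts H = n \<and> avoids H G"
  have fin: "finite (nsets {1..n} 2)"
    by (simp add: finite_imp_finite_nsets)
  obtain u v where "{u, v} \<in> edges G"
    using assms by (fastforce simp: ordered_graph_def nsets_2_eq)
  then have "?P \<lparr>nverts = n, edges = {}\<rparr>"
    by (auto simp: ordered_graph_def avoids_def contains_def)
  moreover have "\<forall>H. ?P H \<longrightarrow> card (edges H) < Suc (card (nsets {1..n} 2))"
    unfolding ordered_graph_def verts_def less_Suc_eq_le using card_mono[OF fin] by blast
  ultimately obtain H where H: "?P H" and max: "\<And>H'. ?P H' \<Longrightarrow> card (edges H') \<le> card (edges H)"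
    using ex_has_greatest_nat[of ?P _ "\<lambda>H. card (edges H)"] by blast
  have "contains (add_edge e H) G" if e: "e \<in> nsets (verts H) 2 - edges H" for e
  proof (rule ccontr)
    assume "\<not> contains (add_edge e H) G"
    then have "?P (add_edge e H)"
      using H e by (auto simp: add_edge_def avoids_def ordered_graph_def verts_def)
    then have "card (edges (add_edge e H)) \<le> card (edges H)"
      by (rule max)
    moreover have "finite (edges H)"
      using H fin by (auto simp: ordered_graph_def verts_def intro: finite_subset)
    ultimately show False
      using e by (simp add: add_edge_def)
  qed
  then show ?thesis
    using H by (auto simp: saturates_def)
qed

lemma sat_attained:
  assumes "ordered_graph G" and "edges G \<noteq> {}"
  shows "\<exists>H. ordered_graph H \<and> nverts H = n \<and> saturates H G \<and> card (edges H) = sat n G"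
  unfolding sat_def by (rule LeastI_ex) (use saturating_exists[OF assms] in blast)

lemma sat_le:
  assumes "ordered_graph H" and "nverts H = n" and "saturates H G"
  shows "sat n G \<le> card (edges H)"
  unfolding sat_def by (rule Least_le) (use assms in blast)

definition G1 :: ograph where
  "G1 = \<lparr>nverts = 8, edges = {{1, 3}, {2, 7}, {4, 5}, {6, 8}}\<rparr>"

definition G2 :: ograph where
  "G2 = \<lparr>nverts = 10, edges = {{1, 5}, {2, 3}, {4, 7}, {6, 10}, {8, 9}}\<rparr>"

definition G3 :: ograph where
  "G3 = \<lparr>nverts = 10, edges = {{1, 5}, {2, 3}, {4, 9}, {6, 7}, {8, 10}}\<rparr>"

definition G4 :: ograph where
  "G4 = \<lparr>nverts = 10, edges = {{1, 3}, {2, 7}, {4, 5}, {6, 10}, {8, 9}}\<rparr>"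

lemma ordered_graph_G:
  "ordered_graph G1" "ordered_graph G2" "ordered_graph G3" "ordered_graph G4"
  by (simp_all add: ordered_graph_def verts_def nsets_def G1_def G2_def G3_def G4_def)

end

theory Submission
  imports Defs
begin

text \<open>
  A witness for \<open>G\<close> is a graph avoiding \<open>G\<close> with a marked gap between two consecutive vertices,
  such that a copy of \<open>G\<close> appears as soon as either one new vertex is placed in the gap and joined
  to any old vertex, or two new vertices are placed in the gap and joined to each other.
  However many isolated vertices are inserted into the gap, \<open>G\<close> is still avoided, since \<open>G\<close> has no
  isolated vertices, and every edge meeting the inserted vertices creates \<open>G\<close>. Adding greedily
  edges between the old vertices then gives a saturating graph whose number of edges is at most the
  number of pairs of old vertices. The witnesses were found with a SAT solver; that they are
  witnesses is decided by backtracking over the edges of \<open>G\<close>.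
\<close>

section \<open>Executable edge-list encoding of ordered graphs\<close>

definition ograph_of :: "nat \<Rightarrow> (nat \<times> nat) list \<Rightarrow> ograph" where
  "ograph_of n es = \<lparr>nverts = n, edges = (\<lambda>(x, y). {x, y}) ` set es\<rparr>"

text \<open>With pairs kept increasing, an embedding sends listed pairs to listed pairs, so the
  search need not try both orientations.\<close>

definition edge_list :: "nat \<Rightarrow> (nat \<times> nat) list \<Rightarrow> bool" where
  "edge_list n es \<longleftrightarrow> (\<forall>(x, y) \<in> set es. 1 \<le> x \<and> x < y \<and> y \<le> n)"

definition covers :: "nat \<Rightarrow> (nat \<times> nat) list \<Rightarrow> bool" where
  "covers n es \<longleftrightarrow> (\<forall>i \<in> {1..n}. \<exists>(x, y) \<in> set es. i = x \<or> i = y)"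

lemma nverts_ograph_of [simp]: "nverts (ograph_of n es) = n"
  by (simp add: ograph_of_def)

lemma verts_ograph_of [simp]: "verts (ograph_of n es) = {1..n}"
  by (simp add: ograph_of_def verts_def)

lemma verts_add_edge [simp]: "verts (add_edge e H) = verts H"
  by (simp add: add_edge_def verts_def)

lemma edges_add_edge [simp]: "edges (add_edge e H) = insert e (edges H)"
  by (simp add: add_edge_def)

lemma add_edge_ograph_of: "add_edge {x, y} (ograph_of n es) = ograph_of n ((x, y) # es)"
  by (simp add: ograph_of_def add_edge_def)

lemma edge_ograph_of_iff:
  "{u, v} \<in> edges (ograph_of n es) \<longleftrightarrow> (u, v) \<in> set es \<or> (v, u) \<in> set es"
  by (force simp: ograph_of_def doubleton_eq_iff)

lemma ordered_graph_ograph_of: "edge_list n es \<Longrightarrow> ordered_graph (ograph_of n es)"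
  by (auto simp: ordered_graph_def ograph_of_def verts_def edge_list_def)

lemma contains_trans:
  assumes "contains C B" and "contains B A"
  shows "contains C A"
proof -
  obtain \<phi> \<psi> where "\<phi> ` verts A \<subseteq> verts B" "strict_mono_on (verts A) \<phi>"
      "\<forall>u v. {u, v} \<in> edges A \<longrightarrow> {\<phi> u, \<phi> v} \<in> edges B"
      "\<psi> ` verts B \<subseteq> verts C" "strict_mono_on (verts B) \<psi>"
      "\<forall>u v. {u, v} \<in> edges B \<longrightarrow> {\<psi> u, \<psi> v} \<in> edges C"
    using assms by (auto simp: contains_def)
  then show ?thesis
    unfolding contains_def
    by (intro exI[of _ "\<psi> \<circ> \<phi>"]) (auto simp: strict_mono_on_def image_subset_iff)
qed

lemma contains_supergraph:
  assumes "contains H G" and "verts H = verts H'" and "edges H \<subseteq> edges H'"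
  shows "contains H' G"
proof (rule contains_trans)
  show "contains H' H"
    unfolding contains_def using assms(2,3)
    by (intro exI[of _ id]) (auto simp: strict_mono_on_def)
qed fact


section \<open>Deciding containment\<close>

text \<open>Comparing in both directions also forces equal endpoints to have equal images, so
  agreement includes well-definedness on shared vertices.\<close>

fun order_agree :: "(nat \<times> nat) \<times> (nat \<times> nat) \<Rightarrow> (nat \<times> nat) \<times> (nat \<times> nat) \<Rightarrow> bool" where
  "order_agree ((a, b), (c, d)) ((a', b'), (c', d')) \<longleftrightarrow>
    (a < a' \<longleftrightarrow> c < c') \<and> (a' < a \<longleftrightarrow> c' < c) \<and> (a < b' \<longleftrightarrow> c < d') \<and> (b' < a \<longleftrightarrow> d' < c) \<and>
    (b < a' \<longleftrightarrow> d < c') \<and> (a' < b \<longleftrightarrow> c' < d) \<and> (b < b' \<longleftrightarrow> d < d') \<and> (b' < b \<longleftrightarrow> d' < d)"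

text \<open>The accumulator pairs the edges placed so far with their images.\<close>

fun embeds ::
  "(nat \<times> nat) list \<Rightarrow> (nat \<times> nat) list \<Rightarrow> ((nat \<times> nat) \<times> (nat \<times> nat)) list \<Rightarrow> bool" where
  "embeds es [] ps \<longleftrightarrow> True"
| "embeds es (g # gs) ps \<longleftrightarrow>
    list_ex (\<lambda>e. list_all (order_agree (g, e)) ps \<and> embeds es gs ((g, e) # ps)) es"

text \<open>The simplifier evaluates both sides of a conjunction, but not the branches of a conditional
  whose condition is undecided: this form makes it backtrack.\<close>

lemma embeds_Cons_if:
  "embeds es (g # gs) ps \<longleftrightarrow>
    foldr (\<lambda>e b. if (if list_all (order_agree (g, e)) ps then embeds es gs ((g, e) # ps) else False)
      then True else b) es False"
proof -
  have "list_ex (\<lambda>e. P e \<and> Q e) xs \<longleftrightarrow>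
      foldr (\<lambda>e b. if (if P e then Q e else False) then True else b) xs False"
    for P Q and xs :: "(nat \<times> nat) list"
    by (induction xs) auto
  then show ?thesis
    unfolding embeds.simps .
qed

lemmas [code] = embeds.simps(1) embeds_Cons_if

lemma order_agree_sym: "order_agree p q \<Longrightarrow> order_agree q p"
  by (induction p q rule: order_agree.induct) simp

text \<open>A successful search branch leaves its choices in the accumulator; \<open>P\<close> is
  the final accumulator, and pairwise agreement is the invariant of the recursion.\<close>

lemma embeds_imp_assignment:
  assumes "embeds es gs ps" and "\<forall>p \<in> set ps. \<forall>q \<in> set ps. order_agree p q"
    and "\<forall>(a, b) \<in> set gs. a < b" and "\<forall>(c, d) \<in> set es. c < d"
  shows "\<exists>P. fst ` P = fst ` set ps \<union> set gs \<and> snd ` P \<subseteq> snd ` set ps \<union> set es \<and>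
    (\<forall>p \<in> P. \<forall>q \<in> P. order_agree p q)"
  using assms
proof (induction gs arbitrary: ps)
  case Nil
  then show ?case by (intro exI[of _ "set ps"]) simp
next
  case (Cons g gs)
  then obtain e where e: "e \<in> set es" "\<forall>p \<in> set ps. order_agree (g, e) p" "embeds es gs ((g, e) # ps)"
    by (auto simp: list_ex_iff list_all_iff)
  \<comment> \<open>The search never compares a pair with itself; that case follows from both edges
    being increasing.\<close>
  have "order_agree (g, e) (g, e)"
    using Cons.prems(3,4) e(1) by (cases g; cases e) auto
  then obtain P where "fst ` P = fst ` set ((g, e) # ps) \<union> set gs"
      "snd ` P \<subseteq> snd ` set ((g, e) # ps) \<union> set es" "\<forall>p \<in> P. \<forall>q \<in> P. order_agree p q"
    using Cons.IH[OF e(3)] Cons.prems e(2) order_agree_sym by auto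
  then show ?case
    using e(1) by (intro exI[of _ P]) auto
qed

text \<open>The branch that places each edge on its image under \<open>\<phi>\<close> passes every
  order test.\<close>

lemma strict_mono_imp_embeds:
  assumes "strict_mono_on A \<phi>" and "\<forall>(a, b) \<in> set gs. a \<in> A \<and> b \<in> A \<and> (\<phi> a, \<phi> b) \<in> set es"
    and "\<forall>((a, b), e) \<in> set ps. a \<in> A \<and> b \<in> A \<and> e = (\<phi> a, \<phi> b)"
  shows "embeds es gs ps"
  using assms(2,3)
proof (induction gs arbitrary: ps)
  case Nil
  then show ?case by simp
next
  case (Cons g gs)
  obtain a b where g: "g = (a, b)" by force
  have ab: "a \<in> A" "b \<in> A" "(\<phi> a, \<phi> b) \<in> set es" using Cons.prems g by auto
  have "order_agree (g, (\<phi> a, \<phi> b)) p" if "p \<in> set ps" for p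
  proof -
    obtain a' b' e where p: "p = ((a', b'), e)"
      by (metis surj_pair)
    then have "a' \<in> A" "b' \<in> A" "e = (\<phi> a', \<phi> b')"
      using Cons.prems(2) that by auto
    then show ?thesis
      unfolding p g using ab by (simp add: strict_mono_on_less[OF assms(1)])
  qed
  moreover have "embeds es gs ((g, (\<phi> a, \<phi> b)) # ps)"
    using Cons.prems ab g by (intro Cons.IH) auto
  ultimately show ?case
    using ab(3) unfolding embeds.simps list_ex_iff list_all_iff by blast
qed

lemma contains_iff_embeds:
  assumes gs: "edge_list k gs" "covers k gs" and es: "edge_list n es"
  shows "contains (ograph_of n es) (ograph_of k gs) \<longleftrightarrow> embeds es gs []"
proof
  assume "contains (ograph_of n es) (ograph_of k gs)"
  then obtain \<phi> where \<phi>: "strict_mono_on {1..k} \<phi>"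
    and E: "\<And>u v. {u, v} \<in> edges (ograph_of k gs) \<Longrightarrow> {\<phi> u, \<phi> v} \<in> edges (ograph_of n es)"
    by (auto simp: contains_def)
  have "a \<in> {1..k} \<and> b \<in> {1..k} \<and> (\<phi> a, \<phi> b) \<in> set es" if "(a, b) \<in> set gs" for a b
  proof -
    have ab: "a \<in> {1..k}" "b \<in> {1..k}" "a < b" using gs(1) that by (auto simp: edge_list_def)
    then have "\<phi> a < \<phi> b" using \<phi> by (simp add: strict_mono_on_less)
    moreover have "(\<phi> a, \<phi> b) \<in> set es \<or> (\<phi> b, \<phi> a) \<in> set es"
      using E[of a b] that by (simp add: edge_ograph_of_iff)
    ultimately show ?thesis using es ab by (auto simp: edge_list_def)
  qed
  then show "embeds es gs []"
    by (intro strict_mono_imp_embeds[OF \<phi>]) auto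
next
  assume "embeds es gs []"
  then obtain P where P: "fst ` P = set gs" "snd ` P \<subseteq> set es" "\<forall>p \<in> P. \<forall>q \<in> P. order_agree p q"
    using embeds_imp_assignment[of es gs "[]"] gs(1) es by (fastforce simp: edge_list_def)
  \<comment> \<open>The assignment of edges to edges is read as a relation between vertices. Order
    agreement makes it single-valued and monotone, and \<open>covers\<close> makes it total on the
    vertices of the pattern.\<close>
  define R where "R i c \<longleftrightarrow> (\<exists>a b c' d. ((a, b), (c', d)) \<in> P \<and> (i = a \<and> c = c' \<or> i = b \<and> c = d))"
    for i c
  have R_less: "i < j \<longleftrightarrow> c < d" if "R i c" "R j d" for i j c d
    using that P(3) unfolding R_def by fastforce
  have R_unique: "c = d" if "R i c" "R i d" for i c d
    using R_less[OF that] R_less[OF that(2,1)] by simp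
  have "\<exists>c. R i c" if i: "i \<in> {1..k}" for i
  proof -
    obtain a b where ab: "(a, b) \<in> set gs" "i = a \<or> i = b"
      using gs(2) i by (fastforce simp: covers_def)
    then obtain c d where "((a, b), (c, d)) \<in> P"
      unfolding P(1)[symmetric] by force
    then show ?thesis using ab(2) unfolding R_def by blast
  qed
  then obtain \<phi> where \<phi>: "\<And>i. i \<in> {1..k} \<Longrightarrow> R i (\<phi> i)" by metis
  have "\<phi> ` {1..k} \<subseteq> {1..n}"
  proof
    fix c assume "c \<in> \<phi> ` {1..k}"
    then obtain i where "R i c" using \<phi> by blast
    then obtain a b where "(a, b) \<in> set es" "c = a \<or> c = b"
      using P(2) unfolding R_def by force
    then show "c \<in> {1..n}" using es by (force simp: edge_list_def)
  qed
  moreover have "strict_mono_on {1..k} \<phi>"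
    using R_less[OF \<phi> \<phi>] by (intro strict_mono_onI) blast
  moreover have E: "(\<phi> a, \<phi> b) \<in> set es" if ab: "(a, b) \<in> set gs" for a b
  proof -
    obtain c d where cd: "((a, b), (c, d)) \<in> P"
      using ab unfolding P(1)[symmetric] by force
    then have "R a c" "R b d" unfolding R_def by blast+
    moreover have "a \<in> {1..k}" "b \<in> {1..k}" using gs(1) ab by (auto simp: edge_list_def)
    ultimately have "\<phi> a = c" "\<phi> b = d" using \<phi> R_unique by blast+
    then show ?thesis using cd P(2) by force
  qed
  ultimately show "contains (ograph_of n es) (ograph_of k gs)"
    unfolding contains_def by (intro exI[of _ \<phi>]) (auto simp: edge_ograph_of_iff)
qed


section \<open>Inserting isolated vertices into a gap\<close>

definition shift :: "nat \<Rightarrow> nat \<Rightarrow> nat \<Rightarrow> nat" where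
  "shift l d x = (if x \<le> l then x else x + d)"

definition blowup :: "nat \<Rightarrow> nat \<Rightarrow> (nat \<times> nat) list \<Rightarrow> (nat \<times> nat) list" where
  "blowup l d es = map (\<lambda>(x, y). (shift l d x, shift l d y)) es"

lemma shift_less_iff [simp]: "shift l d x < shift l d y \<longleftrightarrow> x < y"
  by (auto simp: shift_def)

lemma shift_ge: "x \<le> shift l d x"
  by (simp add: shift_def)

lemma shift_le: "shift l d x \<le> x + d"
  by (simp add: shift_def)

lemma shift_not_in_gap: "shift l d x \<notin> {l<..l + d}"
  by (auto simp: shift_def)

lemma set_blowup: "set (blowup l d es) = (\<lambda>(x, y). (shift l d x, shift l d y)) ` set es"
  by (simp add: blowup_def)

lemma edge_list_blowup:
  assumes "edge_list m es"
  shows "edge_list (m + d) (blowup l d es)"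
proof -
  have "1 \<le> shift l d x \<and> shift l d x < shift l d y \<and> shift l d y \<le> m + d"
    if "(x, y) \<in> set es" for x y
    using assms that shift_ge[of x l d] shift_le[of l d y] by (auto simp: edge_list_def)
  then show ?thesis
    by (auto simp: edge_list_def set_blowup)
qed

text \<open>By \<open>covers\<close>, each vertex of a copy lies on an edge and is thus a shifted
  old vertex; undoing the shift would give a copy in the original graph.\<close>

lemma avoids_blowup:
  assumes es: "edge_list m es" and gs: "edge_list k gs" "covers k gs"
    and av: "avoids (ograph_of m es) (ograph_of k gs)"
  shows "avoids (ograph_of (m + d) (blowup l d es)) (ograph_of k gs)"
  unfolding avoids_def
proof
  assume "contains (ograph_of (m + d) (blowup l d es)) (ograph_of k gs)"
  then obtain \<phi> where \<phi>: "strict_mono_on {1..k} \<phi>"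
    and E: "\<And>u v. {u, v} \<in> edges (ograph_of k gs) \<Longrightarrow>
        {\<phi> u, \<phi> v} \<in> edges (ograph_of (m + d) (blowup l d es))"
    by (auto simp: contains_def)
  have inj: "x = y" if "shift l d x = shift l d y" for x y
    using that by (metis shift_less_iff linorder_neqE_nat order_less_irrefl)
  have "\<exists>x \<in> {1..m}. \<phi> i = shift l d x" if i: "i \<in> {1..k}" for i
  proof -
    obtain a b where ab: "(a, b) \<in> set gs" "i = a \<or> i = b"
      using gs(2) i by (fastforce simp: covers_def)
    then have "(\<phi> a, \<phi> b) \<in> set (blowup l d es) \<or> (\<phi> b, \<phi> a) \<in> set (blowup l d es)"
      using E[of a b] by (simp add: edge_ograph_of_iff)
    then show ?thesis
      using ab(2) es by (fastforce simp: edge_list_def set_blowup)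
  qed
  then obtain \<psi> where \<psi>: "\<And>i. i \<in> {1..k} \<Longrightarrow> \<psi> i \<in> {1..m} \<and> \<phi> i = shift l d (\<psi> i)"
    by metis
  have "strict_mono_on {1..k} \<psi>"
    using \<phi> \<psi> by (simp add: strict_mono_on_def)
  moreover have "{\<psi> u, \<psi> v} \<in> edges (ograph_of m es)" if "{u, v} \<in> edges (ograph_of k gs)" for u v
  proof -
    have "u \<in> {1..k}" "v \<in> {1..k}"
      using that gs(1) by (auto simp: edge_ograph_of_iff edge_list_def)
    then show ?thesis
      using E[OF that] \<psi> by (fastforce simp: edge_ograph_of_iff set_blowup dest: inj)
  qed
  ultimately have "contains (ograph_of m es) (ograph_of k gs)"
    unfolding contains_def using \<psi> by (intro exI[of _ \<psi>]) auto
  then show False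
    using av by (simp add: avoids_def)
qed

text \<open>The map \<open>\<theta>\<close> embeds the graph with \<open>c\<close> inserted vertices
  into the one with \<open>d\<close>, matching the old vertices, so copies found for small
  \<open>c\<close> carry over to every suitable \<open>d\<close>.\<close>

lemma contains_blowup_add_edge:
  assumes "strict_mono_on {1..m + c} \<theta>" and "\<theta> ` {1..m + c} \<subseteq> {1..m + d}"
    and \<theta>: "\<And>x. x \<in> {1..m} \<Longrightarrow> \<theta> (shift l c x) = shift l d x"
    and es: "edge_list m es"
    and "contains (add_edge {x, y} (ograph_of (m + c) (blowup l c es))) G"
  shows "contains (add_edge {\<theta> x, \<theta> y} (ograph_of (m + d) (blowup l d es))) G"
proof (rule contains_trans)
  have "(\<theta> u, \<theta> v) \<in> set (blowup l d es)" if uv: "(u, v) \<in> set (blowup l c es)" for u v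
  proof -
    obtain a b where ab: "(a, b) \<in> set es" "u = shift l c a" "v = shift l c b"
      using uv by (auto simp: set_blowup)
    then have "a \<in> {1..m}" "b \<in> {1..m}" using es by (auto simp: edge_list_def)
    then show ?thesis using ab \<theta> by (force simp: set_blowup)
  qed
  then have "{\<theta> u, \<theta> v} \<in> edges (ograph_of (m + d) ((\<theta> x, \<theta> y) # blowup l d es))"
    if "{u, v} \<in> edges (ograph_of (m + c) ((x, y) # blowup l c es))" for u v
    using that by (auto simp: edge_ograph_of_iff)
  then show "contains (add_edge {\<theta> x, \<theta> y} (ograph_of (m + d) (blowup l d es)))
      (add_edge {x, y} (ograph_of (m + c) (blowup l c es)))"
    unfolding add_edge_ograph_of contains_def using assms(1,2) by (intro exI[of _ \<theta>]) simp
qed fact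

text \<open>A new edge has one or two endpoints in the gap; the other inserted vertices can be
  ignored, so gaps of size 1 and 2 decide all sizes.\<close>

lemma contains_gap_edge:
  assumes es: "edge_list m es" and l: "l \<le> m" and xy: "x \<in> {1..m + d}" "y \<in> {1..m + d}" "x \<noteq> y"
    and gap: "x \<in> {l<..l + d}"
    and one: "\<And>w. w \<in> {1..m + 1} - {l + 1} \<Longrightarrow>
        contains (add_edge {l + 1, w} (ograph_of (m + 1) (blowup l 1 es))) G"
    and two: "contains (add_edge {l + 1, l + 2} (ograph_of (m + 2) (blowup l 2 es))) G"
  shows "contains (add_edge {x, y} (ograph_of (m + d) (blowup l d es))) G"
proof (cases "y \<in> {l<..l + d}")
  case True
  define a b where "a = min x y" and "b = max x y"
  have ab: "a < b" "a \<in> {l<..l + d}" "b \<in> {l<..l + d}" "{x, y} = {a, b}"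
    using True gap xy(3) by (auto simp: a_def b_def min_def max_def)
  \<comment> \<open>The two inserted vertices go to the ends of the new edge in increasing order; an
    old vertex past the gap trades its offset 2 for \<open>d\<close>.\<close>
  define \<theta> where
    "\<theta> q = (if q \<le> l then q else if q = l + 1 then a else if q = l + 2 then b else q + d - 2)" for q
  have "contains (add_edge {\<theta> (l + 1), \<theta> (l + 2)} (ograph_of (m + d) (blowup l d es))) G"
  proof (rule contains_blowup_add_edge[OF _ _ _ es two])
    show "strict_mono_on {1..m + 2} \<theta>"
      using ab by (intro strict_mono_onI) (auto simp: \<theta>_def)
    show "\<theta> ` {1..m + 2} \<subseteq> {1..m + d}"
      using ab l by (auto simp: \<theta>_def)
    show "\<theta> (shift l 2 z) = shift l d z" if "z \<in> {1..m}" for z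
      by (auto simp: \<theta>_def shift_def)
  qed
  then show ?thesis unfolding ab(4) by (simp add: \<theta>_def)
next
  case False
  define \<theta> where "\<theta> q = (if q \<le> l then q else if q = l + 1 then x else q + d - 1)" for q
  \<comment> \<open>This is \<open>y\<close> renumbered for a gap of size 1. Past the gap
    \<open>y > l + d\<close>, so the subtraction is not truncated.\<close>
  define w where "w = (if y \<le> l then y else y + 1 - d)"
  have "\<theta> w = y" "w \<in> {1..m + 1} - {l + 1}"
    using False xy l by (auto simp: \<theta>_def w_def)
  have "contains (add_edge {\<theta> (l + 1), \<theta> w} (ograph_of (m + d) (blowup l d es))) G"
  proof (rule contains_blowup_add_edge[OF _ _ _ es one])
    show "strict_mono_on {1..m + 1} \<theta>"
      using gap by (intro strict_mono_onI) (auto simp: \<theta>_def)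
    show "\<theta> ` {1..m + 1} \<subseteq> {1..m + d}"
      using gap l by (auto simp: \<theta>_def)
    show "\<theta> (shift l 1 z) = shift l d z" if "z \<in> {1..m}" for z
      by (auto simp: \<theta>_def shift_def)
  qed fact
  moreover have "\<theta> (l + 1) = x"
    by (simp add: \<theta>_def)
  ultimately show ?thesis
    using \<open>\<theta> w = y\<close> by simp
qed

section \<open>From a gap to a bounded saturation number\<close>

text \<open>Take an inclusion-maximal \<open>G\<close>-avoiding edge set that extends
  \<open>H\<close> and stays off \<open>B\<close>. Non-edges off \<open>B\<close> create
  \<open>G\<close> by maximality; those meeting \<open>B\<close> already do so over
  \<open>H\<close>, hence over any larger edge set. The bound is independent of the size of
  \<open>B\<close>.\<close>

lemma sat_le_of_gap:
  assumes H: "ordered_graph H" "avoids H G" "edges H \<subseteq> nsets (verts H - B) 2"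
    and gap: "\<And>e. e \<in> nsets (verts H) 2 \<Longrightarrow> e \<inter> B \<noteq> {} \<Longrightarrow> contains (add_edge e H) G"
  shows "sat (nverts H) G \<le> card (verts H - B) choose 2"
proof -
  let ?N = "nsets (verts H - B) 2"
  let ?P = "\<lambda>F. edges H \<subseteq> F \<and> F \<subseteq> ?N \<and> avoids (H\<lparr>edges := F\<rparr>) G"
  have fin: "finite ?N"
    by (simp add: finite_imp_finite_nsets verts_def)
  have "finite {F. ?P F}"
    by (rule finite_subset[of _ "Pow ?N"]) (use fin in auto)
  moreover have "edges H \<in> {F. ?P F}"
    using H by simp
  ultimately have "\<exists>F \<in> {F. ?P F}. edges H \<subseteq> F \<and> (\<forall>F' \<in> {F. ?P F}. F \<subseteq> F' \<longrightarrow> F = F')"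
    by (rule finite_has_maximal2)
  then obtain F where F: "?P F" and max: "\<And>F'. ?P F' \<Longrightarrow> F \<subseteq> F' \<Longrightarrow> F = F'"
    unfolding Bex_def Ball_def mem_Collect_eq by blast
  let ?H = "H\<lparr>edges := F\<rparr>"
  have verts: "verts ?H = verts H"
    by (simp add: verts_def)
  have "contains (add_edge e ?H) G" if e: "e \<in> nsets (verts H) 2 - F" for e
  proof (cases "e \<inter> B = {}")
    case True
    then have "e \<in> ?N"
      using e by (auto simp: nsets_def)
    then have "\<not> avoids (H\<lparr>edges := insert e F\<rparr>) G"
      using max[of "insert e F"] F e by auto
    then show ?thesis
      by (simp add: avoids_def add_edge_def)
  next
    case False
    show ?thesis
      by (rule contains_supergraph[OF gap]) (use e False F verts in auto)
  qed
  then have "saturates ?H G"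
    using F verts by (simp add: saturates_def)
  moreover have "ordered_graph ?H"
    using F verts nsets_mono[of "verts H - B" "verts H" 2] by (auto simp: ordered_graph_def)
  ultimately have "sat (nverts H) G \<le> card F"
    using sat_le[of ?H "nverts H" G] by simp
  also have "\<dots> \<le> card ?N"
    using F by (intro card_mono fin) simp
  finally show ?thesis
    by simp
qed

text \<open>The gap lies between the vertices \<open>l\<close> and \<open>l + 1\<close> of \<open>es\<close>, so new vertices get the numbers
  \<open>l + 1\<close>, \<open>l + 2\<close>. The intervals are lists because \<open>code_simp\<close> is slow on set intervals.\<close>

definition witness :: "nat \<Rightarrow> nat \<Rightarrow> (nat \<times> nat) list \<Rightarrow> nat \<Rightarrow> (nat \<times> nat) list \<Rightarrow> bool" where
  "witness l m es k gs \<longleftrightarrow>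
    l \<le> m \<and> edge_list m es \<and> edge_list k gs \<and> covers k gs \<and> \<not> embeds es gs [] \<and>
    (\<forall>w \<in> set [1..<l + 1]. embeds ((w, l + 1) # blowup l 1 es) gs []) \<and>
    (\<forall>w \<in> set [l + 2..<m + 2]. embeds ((l + 1, w) # blowup l 1 es) gs []) \<and>
    embeds ((l + 1, l + 2) # blowup l 2 es) gs []"

text \<open>Inserting \<open>n - m\<close> vertices into the gap reaches any \<open>n\<close> at
  least \<open>m\<close>, while only the \<open>m\<close> old vertices can carry edges, which gives
  the constant \<open>m choose 2\<close>.\<close>

lemma sat_bounded_of_witness:
  assumes "witness l m es k gs"
  shows "(\<lambda>n. real (sat n (ograph_of k gs))) \<in> O(\<lambda>_. 1)"
proof -
  let ?G = "ograph_of k gs"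
  have l: "l \<le> m" and es: "edge_list m es" and gs: "edge_list k gs" "covers k gs"
    and av: "\<not> embeds es gs []"
    and below: "\<And>w. w \<in> {1..l} \<Longrightarrow> embeds ((w, l + 1) # blowup l 1 es) gs []"
    and above: "\<And>w. w \<in> {l + 2..m + 1} \<Longrightarrow> embeds ((l + 1, w) # blowup l 1 es) gs []"
    and two: "embeds ((l + 1, l + 2) # blowup l 2 es) gs []"
    using assms unfolding witness_def set_upt by auto
  have add: "contains (add_edge {x, y} (ograph_of (m + c) (blowup l c es))) ?G"
    if "embeds ((x, y) # blowup l c es) gs []" "1 \<le> x" "x < y" "y \<le> m + c" for x y c
  proof -
    have "edge_list (m + c) ((x, y) # blowup l c es)"
      using that edge_list_blowup[OF es, of c l] by (simp add: edge_list_def)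
    then show ?thesis
      using that contains_iff_embeds[OF gs] by (simp add: add_edge_ograph_of)
  qed
  \<comment> \<open>The fact \<open>add\<close> expects an increasing pair, so neighbours below and
    above the gap vertex are treated separately.\<close>
  have one: "contains (add_edge {l + 1, w} (ograph_of (m + 1) (blowup l 1 es))) ?G"
    if w: "w \<in> {1..m + 1} - {l + 1}" for w
  proof (cases "w \<le> l")
    case True
    then show ?thesis
      using add[OF below[of w]] w l by (simp add: insert_commute)
  next
    case False
    then show ?thesis
      using add[OF above[of w]] w by simp
  qed
  have two': "contains (add_edge {l + 1, l + 2} (ograph_of (m + 2) (blowup l 2 es))) ?G"
    using add[OF two] l by simp
  have "sat n ?G \<le> m choose 2" if n: "m \<le> n" for n
  proof -
    define d where "d = n - m"
    define B where "B = {l<..l + d}"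
    let ?H = "ograph_of (m + d) (blowup l d es)"
    have el: "edge_list (m + d) (blowup l d es)"
      using edge_list_blowup[OF es] .
    have "sat (nverts ?H) ?G \<le> card (verts ?H - B) choose 2"
    proof (rule sat_le_of_gap)
      show ord: "ordered_graph ?H"
        using ordered_graph_ograph_of[OF el] .
      show "avoids ?H ?G"
        using avoids_blowup[OF es gs] av contains_iff_embeds[OF gs es] by (simp add: avoids_def)
      show "edges ?H \<subseteq> nsets (verts ?H - B) 2"
      proof
        fix e assume "e \<in> edges ?H"
        then obtain x y where "(x, y) \<in> set es" "e = {shift l d x, shift l d y}"
          by (auto simp: ograph_of_def set_blowup)
        then show "e \<in> nsets (verts ?H - B) 2"
          using ord \<open>e \<in> edges ?H\<close> shift_not_in_gap
          unfolding B_def ordered_graph_def nsets_def by auto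
      qed
    next
      fix e assume e: "e \<in> nsets (verts ?H) 2" "e \<inter> B \<noteq> {}"
      then obtain x where x: "x \<in> e" "x \<in> B"
        by blast
      then obtain y where "e = {x, y}" "x \<in> {1..m + d}" "y \<in> {1..m + d}" "x \<noteq> y"
        using e(1) by (fastforce simp: nsets_2_eq)
      then show "contains (add_edge e ?H) ?G"
        using contains_gap_edge[OF es l _ _ _ _ one two'] x(2) by (simp add: B_def)
    qed
    moreover have "card (verts ?H - B) = m"
      using l by (subst card_Diff_subset) (auto simp: B_def)
    ultimately show ?thesis
      using n by (simp add: d_def)
  qed
  \<comment> \<open>The finitely many \<open>n < m\<close> do not affect the asymptotic
    statement.\<close>
  then have "eventually (\<lambda>n. norm (real (sat n ?G)) \<le> real (m choose 2) * norm (1 :: real)) at_top"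
    by (intro eventually_at_top_linorderI[of m]) simp
  then show ?thesis
    by (rule bigoI)
qed

section \<open>The explicit witnesses and their verification\<close>

definition es1 :: "(nat \<times> nat) list" where
  "es1 = [(1, 3), (2, 4), (2, 6), (3, 8), (4, 5), (5, 9), (6, 7), (7, 9), (8, 10)]"

definition es2 :: "(nat \<times> nat) list" where
  "es2 = [(1, 5), (1, 6), (2, 3), (4, 6), (4, 7), (4, 8), (5, 7), (5, 9), (6, 10), (7, 11), (8, 10),
    (8, 11), (9, 11), (9, 14), (10, 14), (12, 13)]"

definition es3 :: "(nat \<times> nat) list" where
  "es3 = [(1, 5), (1, 9), (2, 3), (3, 8), (4, 10), (5, 6), (5, 14), (6, 7), (7, 11), (8, 9),
    (9, 10), (10, 15), (11, 12), (12, 15), (14, 16)]"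

text \<open>\<open>G4\<close> is the reversal of \<open>G3\<close>, so it has the reversed witness.\<close>

definition es4 :: "(nat \<times> nat) list" where
  "es4 = map (\<lambda>(x, y). (17 - y, 17 - x)) es3"

text \<open>The edges of each \<open>G\<close> are ordered so that the search is cut off early.\<close>

lemma witness1: "witness 5 10 es1 8 [(2, 7), (4, 5), (1, 3), (6, 8)]"
  by code_simp

lemma witness2: "witness 7 14 es2 10 [(1, 5), (2, 3), (4, 7), (6, 10), (8, 9)]"
  by code_simp

lemma witness3: "witness 10 16 es3 10 [(1, 5), (4, 9), (6, 7), (8, 10), (2, 3)]"
  by code_simp

text \<open>Reversing 16 vertices turns the gap after 10 into the gap after 6; the search order is
  mirrored as well.\<close>

lemma witness4: "witness 6 16 es4 10 [(6, 10), (2, 7), (4, 5), (1, 3), (8, 9)]"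
  by code_simp

theorem theorem4:
  shows "\<forall>G \<in> {G1, G2, G3, G4}. (\<lambda>n. real (sat n G)) \<in> O(\<lambda>_. 1)"
proof -
  \<comment> \<open>The search order of the edges is immaterial here, as \<open>ograph_of\<close>
    keeps only the set of listed pairs.\<close>
  have "G1 = ograph_of 8 [(2, 7), (4, 5), (1, 3), (6, 8)]"
    "G2 = ograph_of 10 [(1, 5), (2, 3), (4, 7), (6, 10), (8, 9)]"
    "G3 = ograph_of 10 [(1, 5), (4, 9), (6, 7), (8, 10), (2, 3)]"
    "G4 = ograph_of 10 [(6, 10), (2, 7), (4, 5), (1, 3), (8, 9)]"
    unfolding G1_def G2_def G3_def G4_def ograph_of_def by (simp_all add: insert_commute)
  then show ?thesis
    using witness1[THEN sat_bounded_of_witness] witness2[THEN sat_bounded_of_witness]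
      witness3[THEN sat_bounded_of_witness] witness4[THEN sat_bounded_of_witness] by simp
qed

end
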